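(* Let $A,B$ be Young diagrams. Then $B$ can be obtained from $A$ by a flip in some row if and only if for every $k$ such that $A,B\in\mathbb{Y}_k$ there is a $k$-flip between $A$ and $B$.
   Context: A Young diagram is a partition $M=(\mu_1,\mu_2,\dots)$, $\mu_1\ge\mu_2\ge\dots\ge 0$ integers, finitely many nonzero (rows of length $0$ are allowed and indexed). $\mathbb{Y}_n$ is the set of diagrams with $\mu_k\le n-k$ for $1\le k\le n-1$ and $\mu_k=0$ for $k\ge n$. Flip in row $k$ ($k\ge1$): define an integer $l$ by: (1) if $\mu_{k+1}=\mu_k$, let $T_k=\{m: m<k,\ m+\mu_m\ge k+\mu_k\}$ and $l=k+\mu_k-\max T_k$ if $T_k\ne\emptyset$, $l=k+\mu_k$ otherwise; (2) if $\mu_{k+1}<\mu_k$, let $T_k=\{m: m>k,\ m+\mu_m\ge k+\mu_k\}$ and $l=k+\mu_k-\min T_k$ if $T_k\neq\emptyset$, $l=0$ otherwise. The diagram $N$ obtained from $M$ by a flip in row $k$ is obtained by deleting row $k$ (of length $\mu_k$) and inserting a row of length $l$, reordering the rows to be nonincreasing. Triangulations: label vertices of a convex $(n+2)$-gon $0,\dots,n+1$ counterclockwise; a triangulation is a maximal set of pairwise non-crossing diagonals; $T_{n+2}$ is the set of them. The tail of a diagonal is its smaller endpoint. $\Lambda_{n+2}:T_{n+2}\to\mathbb{Y}_n$ sends a triangulation to the decreasingly ordered sequence of tails of its $n-1$ diagonals, padded by zeros; it is a bijection. For $A,B\in\mathbb{Y}_n$, there is an $n$-flip between $A$ and $B$ if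 the triangulations $\Lambda_{n+2}^{-1}(A)$ and $\Lambda_{n+2}^{-1}(B)$ differ in exactly one diagonal (i.e. are related by a flip). *)

theory Defs
  imports "HOL-Library.Multiset"
begin

text \<open>
  A Young diagram is the sequence of its row lengths, with rows numbered from 1 and almost all of
  them equal to 0. The value at index 0 is not a row; it is fixed to be 0 so that equality of
  diagrams is equality of functions.
\<close>

definition young_diagram :: "(nat \<Rightarrow> nat) \<Rightarrow> bool" where
  "young_diagram M \<longleftrightarrow> M 0 = 0 \<and> antimono_on {1..} M \<and> finite {k. M k \<noteq> 0}"

definition Y :: "nat \<Rightarrow> (nat \<Rightarrow> nat) set" where
  "Y n = {M. young_diagram M \<and> (\<forall>k. 1 \<le> k \<and> k < n \<longrightarrow> M k \<le> n - k) \<and> (\<forall>k\<ge>n. M k = 0)}"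

definition sorted_rows :: "nat multiset \<Rightarrow> (nat \<Rightarrow> nat)" where
  "sorted_rows D =
    (\<lambda>k. if 1 \<le> k \<and> k \<le> size D then rev (sorted_list_of_multiset D) ! (k - 1) else 0)"

definition reorder :: "(nat \<Rightarrow> nat) \<Rightarrow> (nat \<Rightarrow> nat)" where
  "reorder f = sorted_rows (image_mset f (mset_set {k. 1 \<le> k \<and> f k \<noteq> 0}))"

text \<open>
  In the second case below the set of rows \<open>m\<close> is infinite, so its minimum is taken with \<open>Inf\<close>
  rather than \<open>Min\<close>. For a Young diagram and \<open>k \<ge> 1\<close> no subtraction truncates: in the first case
  the maximum is less than \<open>k\<close>, and in the second case \<open>m = k + M k\<close> belongs to the set.
\<close>

definition flip_length :: "(nat \<Rightarrow> nat) \<Rightarrow> nat \<Rightarrow> nat" where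
  "flip_length M k =
    (if M (k + 1) = M k then
       (let T = {m. 1 \<le> m \<and> m < k \<and> m + M m \<ge> k + M k}
        in if T \<noteq> {} then k + M k - Max T else k + M k)
     else
       (let T = {m. m > k \<and> m + M m \<ge> k + M k}
        in if T \<noteq> {} then k + M k - Inf T else 0))"

definition row_flip :: "(nat \<Rightarrow> nat) \<Rightarrow> nat \<Rightarrow> (nat \<Rightarrow> nat)" where
  "row_flip M k = reorder (M(k := flip_length M k))"

text \<open>
  The vertices of the convex \<open>(n+2)\<close>-gon are \<open>0, \<dots>, n + 1\<close> in cyclic order. A diagonal is encoded
  as the pair of its endpoints, the smaller one (its tail) first; the excluded pair \<open>(0, n + 1)\<close> is
  a side.
\<close>

definition diagonals :: "nat \<Rightarrow> (nat \<times> nat) set" where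
  "diagonals n = {(a, b). a + 1 < b \<and> b \<le> n + 1 \<and> (a, b) \<noteq> (0, n + 1)}"

definition crossing :: "nat \<times> nat \<Rightarrow> nat \<times> nat \<Rightarrow> bool" where
  "crossing d e \<longleftrightarrow>
    (fst d < fst e \<and> fst e < snd d \<and> snd d < snd e) \<or>
    (fst e < fst d \<and> fst d < snd e \<and> snd e < snd d)"

definition noncrossing :: "nat \<Rightarrow> (nat \<times> nat) set \<Rightarrow> bool" where
  "noncrossing n S \<longleftrightarrow> S \<subseteq> diagonals n \<and> (\<forall>d\<in>S. \<forall>e\<in>S. \<not> crossing d e)"

definition triangulations :: "nat \<Rightarrow> (nat \<times> nat) set set" where
  "triangulations n = {S. noncrossing n S \<and> (\<forall>S'. noncrossing n S' \<and> S \<subseteq> S' \<longrightarrow> S' = S)}"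

definition Lambda :: "(nat \<times> nat) set \<Rightarrow> (nat \<Rightarrow> nat)" where
  "Lambda S = sorted_rows (image_mset fst (mset_set S))"

definition triangulation_of :: "nat \<Rightarrow> (nat \<Rightarrow> nat) \<Rightarrow> (nat \<times> nat) set" where
  "triangulation_of n = the_inv_into (triangulations n) Lambda"

definition n_flip :: "nat \<Rightarrow> (nat \<Rightarrow> nat) \<Rightarrow> (nat \<Rightarrow> nat) \<Rightarrow> bool" where
  "n_flip n A B \<longleftrightarrow>
    card (triangulation_of n A - triangulation_of n B) = 1 \<and>
    card (triangulation_of n B - triangulation_of n A) = 1"

end

theory Submission
  imports Defs
begin

text \<open>
  Write $U$ for a triangulation together with the side $(0, n + 1)$, and order $U$ by decreasing
  tail and, for equal tails, by increasing head; the position of a chord $(a, b)$ is then a row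
  $k$ of length $a$ of the diagram. Counting the chords below $(a, b)$ gives
  $k + a = b - 1 + r(b)$, where $r(b)$ is the number of rows of length at least $b$. The
  right-hand side is smaller at every vertex strictly between $a$ and $b$, so $b$ is the
  least vertex above $a$ at which it reaches $k + a$. Hence the diagram determines the
  triangulation, and the comparison $m + \mu_m \ge k + \mu_k$ in the definition of a flip detects the
  next chord ending at $b$ or beyond, which is a side of the quadrilateral around the flipped
  diagonal. The triangulation for $n + 1$ has just the additional diagonal $(0, n + 1)$, so the
  value of $n$ does not matter.
\<close>

section \<open>Sequences given by their conjugate\<close>

text \<open>The column lengths of a Young diagram, that is, its conjugate partition. Sorted
  sequences are handled through the equivalence of \<open>t \<le> M k\<close> and
  \<open>k \<le> rows_ge M t\<close> for positive \<open>k\<close> and \<open>t\<close>, which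
  replaces sorting by counting.\<close>

definition rows_ge :: "(nat \<Rightarrow> nat) \<Rightarrow> nat \<Rightarrow> nat" where
  "rows_ge M t = card {m. 1 \<le> m \<and> t \<le> M m}"

text \<open>In a nonincreasing list the entries that are at least \<open>t\<close> form a prefix, so
  their number decides.\<close>

lemma decreasing_nth_ge_iff:
  fixes ys :: "nat list"
  assumes "sorted_wrt (\<ge>) ys" "i < length ys"
  shows "t \<le> ys ! i \<longleftrightarrow> i < length (filter ((\<le>) t) ys)"
  using assms
proof (induction ys arbitrary: i)
  case (Cons y ys)
  show ?case
  proof (cases "t \<le> y")
    case True
    then show ?thesis using Cons by (cases i) auto
  next
    case False
    then have "\<forall>z\<in>set (y # ys). \<not> t \<le> z" using Cons.prems(1) by auto
    then have "filter ((\<le>) t) (y # ys) = []" by (simp add: filter_empty_conv)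
    moreover have "\<not> t \<le> (y # ys) ! i"
      using \<open>\<forall>z\<in>set (y # ys). \<not> t \<le> z\<close> Cons.prems(2) nth_mem by blast
    ultimately show ?thesis by simp
  qed
qed simp

lemma sorted_rows_ge_iff:
  assumes "1 \<le> k" "1 \<le> t"
  shows "t \<le> sorted_rows D k \<longleftrightarrow> k \<le> size (filter_mset ((\<le>) t) D)"
proof -
  define ys where "ys = rev (sorted_list_of_multiset D)"
  have mset: "mset ys = D" by (simp add: ys_def)
  have len: "length ys = size D" using mset by (metis size_mset)
  have "sorted_wrt (\<ge>) ys" by (simp add: ys_def sorted_wrt_rev)
  moreover have count: "size (filter_mset ((\<le>) t) D) = length (filter ((\<le>) t) ys)"
    by (metis mset mset_filter size_mset)
  ultimately show ?thesis
    using assms decreasing_nth_ge_iff[of ys "k - 1" t] len size_filter_mset_lesseq[of "(\<le>) t" D]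
    by (auto simp: sorted_rows_def ys_def[symmetric])
qed

lemma Lambda_ge_iff:
  assumes "finite S" "1 \<le> k" "1 \<le> t"
  shows "t \<le> Lambda S k \<longleftrightarrow> k \<le> card {e \<in> S. t \<le> fst e}"
proof -
  have "size (filter_mset ((\<le>) t) (image_mset fst (mset_set S))) = card {e \<in> S. t \<le> fst e}"
    using assms(1) by (simp add: filter_mset_image_mset)
  then show ?thesis using assms by (simp add: Lambda_def sorted_rows_ge_iff)
qed

lemma reorder_ge_iff:
  assumes "finite {k. f k \<noteq> 0}" "1 \<le> k" "1 \<le> t"
  shows "t \<le> reorder f k \<longleftrightarrow> k \<le> rows_ge f t"
proof -
  have fin: "finite {k. 1 \<le> k \<and> f k \<noteq> 0}"
    by (rule finite_subset[OF _ assms(1)]) auto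
  have "{j \<in> {k. 1 \<le> k \<and> f k \<noteq> 0}. t \<le> f j} = {j. 1 \<le> j \<and> t \<le> f j}" using assms(3) by auto
  then have "size (filter_mset ((\<le>) t) (image_mset f (mset_set {k. 1 \<le> k \<and> f k \<noteq> 0}))) = rows_ge f t"
    using fin by (simp add: filter_mset_image_mset rows_ge_def)
  then show ?thesis using assms by (simp add: reorder_def sorted_rows_ge_iff)
qed

lemma sorted_rows_0: "sorted_rows D 0 = 0"
  by (simp add: sorted_rows_def)

lemma eq_if_ge_iff:
  fixes f g :: "nat \<Rightarrow> nat"
  assumes "f 0 = g 0" "\<And>k t. 1 \<le> k \<Longrightarrow> 1 \<le> t \<Longrightarrow> t \<le> f k \<longleftrightarrow> t \<le> g k"
  shows "f = g"
proof
  fix k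
  show "f k = g k"
  proof (cases k)
    case (Suc j)
    then have "1 \<le> t \<Longrightarrow> t \<le> f k \<longleftrightarrow> t \<le> g k" for t using assms(2) by simp
    from this[of "f k"] this[of "g k"] show ?thesis by (cases "f k"; cases "g k") auto
  qed (use assms in simp)
qed

lemma finite_rows_ge:
  assumes "finite {k. M k \<noteq> (0::nat)}" "1 \<le> t"
  shows "finite {m. 1 \<le> m \<and> t \<le> M m}"
  by (rule finite_subset[OF _ assms(1)]) (use assms(2) in auto)

lemma young_antimono: "young_diagram M \<Longrightarrow> 1 \<le> i \<Longrightarrow> i \<le> j \<Longrightarrow> M j \<le> M i"
  unfolding young_diagram_def monotone_on_def by simp

lemma young_ge_iff:
  assumes "young_diagram M" "1 \<le> k" "1 \<le> t"
  shows "t \<le> M k \<longleftrightarrow> k \<le> rows_ge M t"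
proof -
  let ?R = "{m. 1 \<le> m \<and> t \<le> M m}"
  have anti: "1 \<le> i \<Longrightarrow> i \<le> j \<Longrightarrow> M j \<le> M i" for i j
    using young_antimono[OF assms(1)] .
  have fin: "finite ?R" using assms finite_rows_ge unfolding young_diagram_def by blast
  have "k \<le> card ?R" if "t \<le> M k"
  proof -
    have "{1..k} \<subseteq> ?R" using that anti order_trans by fastforce
    from card_mono[OF fin this] show ?thesis by simp
  qed
  moreover have "card ?R < k" if "\<not> t \<le> M k"
  proof -
    have "?R \<subseteq> {1..<k}" using that anti order_trans[of t] assms(2)
      by (metis (mono_tags, lifting) atLeastLessThan_iff leI mem_Collect_eq subsetI)
    from card_mono[OF _ this] have "card ?R \<le> k - 1" by simp
    then show ?thesis using assms(2) by linarith
  qed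
  ultimately show ?thesis unfolding rows_ge_def by linarith
qed

lemma young_if_ge_iff:
  assumes "M 0 = 0" "\<And>k t. 1 \<le> k \<Longrightarrow> 1 \<le> t \<Longrightarrow> t \<le> M k \<longleftrightarrow> k \<le> N t"
  shows "young_diagram M"
proof -
  have "M j \<le> M i" if "1 \<le> i" "i \<le> j" for i j
    using assms(2)[of j "M j"] assms(2)[of i "M j"] that by (cases "M j") auto
  moreover have "{k. M k \<noteq> 0} \<subseteq> {..N 1}"
  proof
    fix k assume "k \<in> {k. M k \<noteq> 0}"
    then show "k \<in> {..N 1}" using assms(1) assms(2)[of k 1] by (cases k) auto
  qed
  then have "finite {k. M k \<noteq> 0}" by (rule finite_subset) simp
  ultimately show ?thesis using assms(1) by (auto simp: young_diagram_def monotone_on_def)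
qed

lemma young_Lambda: "finite S \<Longrightarrow> young_diagram (Lambda S)"
  by (rule young_if_ge_iff[where N = "\<lambda>t. card {e \<in> S. t \<le> fst e}"])
    (use Lambda_ge_iff sorted_rows_0 in \<open>auto simp: Lambda_def\<close>)

lemma rows_ge_Lambda:
  assumes "finite S" "1 \<le> t"
  shows "rows_ge (Lambda S) t = card {e \<in> S. t \<le> fst e}"
proof -
  have "{m. 1 \<le> m \<and> t \<le> Lambda S m} = {1..card {e \<in> S. t \<le> fst e}}"
    using Lambda_ge_iff[OF assms(1) _ assms(2)] by auto
  then show ?thesis by (simp add: rows_ge_def)
qed

section \<open>Triangulations\<close>

lemma finite_diagonals: "finite (diagonals n)"
  by (rule finite_subset[of _ "{..n+1} \<times> {..n+1}"]) (auto simp: diagonals_def)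

lemma triangulation_extends:
  assumes "noncrossing n S"
  obtains S' where "S' \<in> triangulations n" "S \<subseteq> S'"
proof -
  have "finite {S. noncrossing n S}"
    by (rule finite_subset[of _ "Pow (diagonals n)"]) (auto simp: noncrossing_def finite_diagonals)
  from finite_has_maximal2[OF this, of S] assms show ?thesis
    using that unfolding triangulations_def by blast
qed

locale triangulation =
  fixes n :: nat and S :: "(nat \<times> nat) set"
  assumes n_pos: "1 \<le> n" and tri: "S \<in> triangulations n"
begin

abbreviation U :: "(nat \<times> nat) set" where "U \<equiv> insert (0, n + 1) S"

definition edge :: "nat \<Rightarrow> nat \<Rightarrow> bool" where
  "edge a b \<longleftrightarrow> b = a + 1 \<or> (a, b) \<in> U"

abbreviation M :: "nat \<Rightarrow> nat" where "M \<equiv> Lambda S"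

lemma S_diagonals: "S \<subseteq> diagonals n"
  using tri by (auto simp: triangulations_def noncrossing_def)

lemma fin_S: "finite S"
  using S_diagonals finite_diagonals finite_subset by blast

lemma U_bounds: "(a, b) \<in> U \<Longrightarrow> a + 1 < b \<and> b \<le> n + 1"
  using S_diagonals n_pos by (auto simp: diagonals_def)

lemma root_notin: "(0, n + 1) \<notin> S"
  using S_diagonals by (auto simp: diagonals_def)

lemma U_not_crossing: "e \<in> U \<Longrightarrow> f \<in> U \<Longrightarrow> \<not> crossing e f"
proof -
  have *: "\<not> crossing (0, n + 1) f \<and> \<not> crossing f (0, n + 1)" if "f \<in> U" for f
    using that U_bounds[of "fst f" "snd f"] by (auto simp: crossing_def)
  have "\<not> crossing e f" if "e \<in> S" "f \<in> S"
    using tri that by (auto simp: triangulations_def noncrossing_def)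
  then show "e \<in> U \<Longrightarrow> f \<in> U \<Longrightarrow> \<not> crossing e f" using * by blast
qed

lemma edge_less: "edge a b \<Longrightarrow> a < b"
  using U_bounds by (fastforce simp: edge_def)

lemma U_edge: "(a, b) \<in> U \<Longrightarrow> edge a b"
  by (simp add: edge_def)

lemma edge_not_crossing:
  assumes "edge a b" "(x, y) \<in> U"
  shows "\<not> (a < x \<and> x < b \<and> b < y)" "\<not> (x < a \<and> a < y \<and> y < b)"
  using assms U_not_crossing[of "(a, b)" "(x, y)"] by (auto simp: edge_def crossing_def)

lemma U_maximal:
  assumes "a + 1 < b" "b \<le> n + 1" "\<And>x y. (x, y) \<in> S \<Longrightarrow> \<not> crossing (a, b) (x, y)"
  shows "(a, b) \<in> U"
proof (cases "(a, b) = (0, n + 1)")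
  case False
  have sym: "crossing e f \<longleftrightarrow> crossing f e" for e f by (auto simp: crossing_def)
  have "noncrossing n (insert (a, b) S)"
    using False assms S_diagonals U_not_crossing sym
    by (auto simp: noncrossing_def diagonals_def crossing_def[of "(a,b)" "(a,b)"])
  then have "insert (a, b) S = S" using tri unfolding triangulations_def by blast
  then show ?thesis by blast
qed simp

text \<open>Take for \<open>d\<close> the largest neighbour of \<open>a\<close> below
  \<open>b\<close>. A diagonal crossing \<open>(d, b)\<close> would cross \<open>(a, b)\<close> or
  \<open>(a, d)\<close>, or would join \<open>a\<close> to a vertex strictly between
  \<open>d\<close> and \<open>b\<close>, against the choice of \<open>d\<close>. By maximality
  \<open>(d, b)\<close> is an edge.\<close>

lemma apex:
  assumes "(a, b) \<in> U"
  obtains d where "a < d" "d < b" "edge a d" "edge d b"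
proof -
  let ?D = "{d. d < b \<and> edge a d}"
  define d where "d = Max ?D"
  have "a + 1 \<in> ?D" using U_bounds[OF assms] by (simp add: edge_def)
  then have "d \<in> ?D" unfolding d_def by (intro Max_in) auto
  then have d: "d < b" "edge a d" by auto
  have max: "d' \<le> d" if "d' < b" "edge a d'" for d'
    unfolding d_def using that by (intro Max_ge) auto
  have "edge d b"
  proof (rule ccontr)
    assume not: "\<not> edge d b"
    have "(d, b) \<in> U"
    proof (rule U_maximal)
      show "d + 1 < b" using d not by (simp add: edge_def)
      show "b \<le> n + 1" using U_bounds[OF assms] by simp
      fix x y assume xy: "(x, y) \<in> S"
      have "\<not> (a < x \<and> x < b \<and> b < y)" "\<not> (x < a \<and> a < y \<and> y < b)"
        "\<not> (a < x \<and> x < d \<and> d < y)"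
        using edge_not_crossing U_edge[OF assms] d xy by blast+
      moreover have "x = a \<Longrightarrow> y < b \<Longrightarrow> y \<le> d" using max xy U_edge by blast
      ultimately show "\<not> crossing (d, b) (x, y)"
        using edge_less[OF d(2)] by (auto simp: crossing_def)
    qed
    then show False using not U_edge by blast
  qed
  then show ?thesis using that d edge_less by blast
qed

section \<open>Counting chords in subpolygons\<close>

definition inside :: "nat \<Rightarrow> nat \<Rightarrow> (nat \<times> nat) set" where
  "inside a b = {(x, y) \<in> U. a \<le> x \<and> y \<le> b}"

lemma fin_inside: "finite (inside a b)"
  by (rule finite_subset[of _ U]) (auto simp: inside_def fin_S)

text \<open>The count consists of the diagonals of the polygon with vertices
  \<open>a, ..., b\<close> and of its base \<open>(a, b)\<close>; a side gives zero. The apex splits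
  the polygon into two smaller ones.\<close>

lemma card_inside: "edge a b \<Longrightarrow> card (inside a b) = b - a - 1"
proof (induction "b - a" arbitrary: a b rule: less_induct)
  case less
  show ?case
  proof (cases "b = a + 1")
    case True
    then have "inside a b = {}" using U_bounds by (fastforce simp: inside_def)
    with True show ?thesis by simp
  next
    case False
    then have ab: "(a, b) \<in> U" using less.prems by (simp add: edge_def)
    then obtain d where d: "a < d" "d < b" "edge a d" "edge d b" by (rule apex)
    have split: "inside a b = insert (a, b) (inside a d \<union> inside d b)"
    proof (intro equalityI subsetI)
      fix e assume e: "e \<in> inside a b"
      obtain x y where xy: "e = (x, y)" by (cases e)
      with e have "(x, y) \<in> U" "a \<le> x" "y \<le> b" by (auto simp: inside_def)
      with edge_not_crossing[OF d(3), of x y] edge_not_crossing[OF d(4), of x y]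
      show "e \<in> insert (a, b) (inside a d \<union> inside d b)" using xy by (auto simp: inside_def)
    next
      fix e assume "e \<in> insert (a, b) (inside a d \<union> inside d b)"
      then show "e \<in> inside a b" using ab d by (auto simp: inside_def)
    qed
    have disj: "inside a d \<inter> inside d b = {}" "(a, b) \<notin> inside a d \<union> inside d b"
      using d U_bounds by (fastforce simp: inside_def)+
    have "card (inside a b) = Suc (card (inside a d) + card (inside d b))"
      using split disj fin_inside by (simp add: card_Un_disjoint)
    also have "\<dots> = Suc ((d - a - 1) + (b - d - 1))"
      using less.hyps[of d a] less.hyps[of b d] d by simp
    finally show ?thesis using d by simp
  qed
qed

lemma card_U: "card U = n"
proof -
  have "inside 0 (n + 1) = U" using U_bounds by (fastforce simp: inside_def)
  moreover have "card (inside 0 (n + 1)) = n" using card_inside[of 0 "n + 1"] by (simp add: edge_def)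
  ultimately show ?thesis by simp
qed

lemma card_S: "card S = n - 1"
  using card_U root_notin fin_S by simp

definition tails :: "nat \<Rightarrow> nat \<Rightarrow> (nat \<times> nat) set" where
  "tails h b = {e \<in> U. h \<le> fst e \<and> fst e < b}"

text \<open>With \<open>d\<close> the apex, chords with tail in \<open>[d, b)\<close> cannot cross
  \<open>(a, b)\<close>, so they lie inside the polygon over \<open>(d, b)\<close> and number at
  most \<open>b - d - 1\<close>. Tails below \<open>d\<close> are treated by induction on
  \<open>(a, d)\<close>, and the case \<open>d < h\<close> by induction on
  \<open>(d, b)\<close>.\<close>

lemma card_tails_less:
  "(a, b) \<in> U \<Longrightarrow> a < h \<Longrightarrow> h < b \<Longrightarrow> card (tails h b) < b - h"
proof (induction "b - a" arbitrary: a b rule: less_induct)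
  case less
  obtain d where d: "a < d" "d < b" "edge a d" "edge d b" using less.prems(1) by (rule apex)
  have sub: "tails d b \<subseteq> inside d b"
  proof
    fix e assume e: "e \<in> tails d b"
    obtain x y where xy: "e = (x, y)" by (cases e)
    then have "(x, y) \<in> U" "d \<le> x" "x < b" using e by (auto simp: tails_def)
    then show "e \<in> inside d b"
      using edge_not_crossing(1)[OF U_edge[OF less.prems(1)], of x y] d xy by (auto simp: inside_def)
  qed
  have card_d: "card (tails d b) \<le> b - d - 1"
    using card_mono[OF fin_inside sub] card_inside[OF d(4)] by simp
  consider "h < d" | "h = d" | "d < h" by linarith
  then show ?case
  proof cases
    case 1
    then have "(a, d) \<in> U" using d less.prems by (auto simp: edge_def)
    then have "card (tails h d) < d - h" using less.hyps[of d a] d 1 less.prems by simp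
    moreover have "tails h b = tails h d \<union> tails d b" using 1 d by (auto simp: tails_def)
    then have "card (tails h b) \<le> card (tails h d) + card (tails d b)" by (simp add: card_Un_le)
    ultimately show ?thesis using card_d 1 d by linarith
  next
    case 2
    then show ?thesis using card_d d by simp
  next
    case 3
    then have "(d, b) \<in> U" using d less.prems by (auto simp: edge_def)
    then show ?thesis using less.hyps[of b d] d 3 less.prems by simp
  qed
qed

end

text \<open>The row index plus the row length is the same for all chords ending at \<open>b\<close>;
  this is the common value. It is used for positive \<open>b\<close>, where the subtraction does not
  truncate.\<close>

definition level :: "(nat \<Rightarrow> nat) \<Rightarrow> nat \<Rightarrow> nat" where
  "level M b = b - 1 + rows_ge M b"

definition head :: "(nat \<Rightarrow> nat) \<Rightarrow> nat \<Rightarrow> nat" where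
  "head M k = (LEAST b. M k < b \<and> k + M k \<le> level M b)"

section \<open>Recovering the chords from the diagram\<close>

context triangulation
begin

lemma rows_ge_U: "1 \<le> t \<Longrightarrow> rows_ge M t = card {e \<in> U. t \<le> fst e}"
proof -
  assume t: "1 \<le> t"
  then have "{e \<in> U. t \<le> fst e} = {e \<in> S. t \<le> fst e}" by auto
  then show ?thesis using rows_ge_Lambda[OF fin_S t] by simp
qed

text \<open>From \<open>h\<close> to \<open>b\<close> the rows with lengths in \<open>[h, b)\<close>
  are lost. They are fewer than \<open>b - h\<close>, the growth of the other summand.\<close>

lemma level_less:
  assumes "(a, b) \<in> U" "a < h" "h < b"
  shows "level M h < level M b"
proof -
  have "{e \<in> U. h \<le> fst e} = tails h b \<union> {e \<in> U. b \<le> fst e}"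
    using assms by (auto simp: tails_def)
  then have "rows_ge M h \<le> card (tails h b) + rows_ge M b"
    using rows_ge_U[of h] rows_ge_U[of b] assms by (simp add: card_Un_le)
  then show ?thesis using card_tails_less[OF assms] assms by (simp add: level_def)
qed

definition below :: "nat \<Rightarrow> nat \<Rightarrow> (nat \<times> nat) set" where
  "below a b = {(x, y) \<in> U. a < x \<or> x = a \<and> y \<le> b}"

definition rank :: "nat \<Rightarrow> nat \<Rightarrow> nat" where
  "rank a b = card (below a b)"

lemma fin_below: "finite (below a b)"
  by (rule finite_subset[of _ U]) (auto simp: below_def fin_S)

text \<open>A chord with tail strictly between \<open>a\<close> and \<open>b\<close> does not end
  beyond \<open>b\<close>. Hence the chords up to and including \<open>(a, b)\<close> are those
  inside the polygon over it and those with tail at least \<open>b\<close>.\<close>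

lemma rank_level:
  assumes "(a, b) \<in> U"
  shows "rank a b + a = level M b"
proof -
  note ab = U_bounds[OF assms]
  have "below a b = inside a b \<union> {e \<in> U. b \<le> fst e}"
    using edge_not_crossing(1)[OF U_edge[OF assms]] ab
    by (fastforce simp: below_def inside_def dest: U_bounds)
  moreover have "inside a b \<inter> {e \<in> U. b \<le> fst e} = {}"
  proof -
    have "x < b" if "(x, y) \<in> U" "y \<le> b" for x y using U_bounds[OF that(1)] that(2) by simp
    then show ?thesis by (fastforce simp: inside_def)
  qed
  moreover have "finite {e \<in> U. b \<le> fst e}" using fin_S by simp
  ultimately have "rank a b = card (inside a b) + card {e \<in> U. b \<le> fst e}"
    unfolding rank_def by (metis card_Un_disjoint fin_inside)
  then have "rank a b = (b - a - 1) + rows_ge M b"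
    using card_inside[OF U_edge[OF assms]] rows_ge_U[of b] ab by simp
  then show ?thesis using ab by (simp add: level_def)
qed

lemma rank_pos: "(a, b) \<in> U \<Longrightarrow> 1 \<le> rank a b"
  using fin_below[of a b] by (force simp: rank_def below_def Suc_le_eq card_gt_0_iff)

text \<open>The chords with tail at least \<open>t\<close> form an initial segment of the order, and
  it contains \<open>(a, b)\<close> exactly when \<open>t \<le> a\<close>.\<close>

lemma Lambda_rank:
  assumes "(a, b) \<in> U"
  shows "M (rank a b) = a"
proof -
  have "t \<le> M (rank a b) \<longleftrightarrow> t \<le> a" if "1 \<le> t" for t
  proof -
    have "t \<le> M (rank a b) \<longleftrightarrow> rank a b \<le> card {e \<in> U. t \<le> fst e}"
      using Lambda_ge_iff[OF fin_S rank_pos[OF assms] that] rows_ge_U rows_ge_Lambda that fin_S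
      by simp
    also have "\<dots> \<longleftrightarrow> t \<le> a"
    proof
      assume "t \<le> a"
      then have "below a b \<subseteq> {e \<in> U. t \<le> fst e}" by (auto simp: below_def)
      from card_mono[OF _ this] show "rank a b \<le> card {e \<in> U. t \<le> fst e}"
        using fin_S by (simp add: rank_def)
    next
      assume le: "rank a b \<le> card {e \<in> U. t \<le> fst e}"
      show "t \<le> a"
      proof (rule ccontr)
        assume "\<not> t \<le> a"
        then have "{e \<in> U. t \<le> fst e} \<subseteq> below a b - {(a, b)}" by (auto simp: below_def)
        moreover have "(a, b) \<in> below a b" using assms by (simp add: below_def)
        ultimately have "{e \<in> U. t \<le> fst e} \<subset> below a b" by blast
        from psubset_card_mono[OF fin_below this] show False using le by (simp add: rank_def)
      qed
    qed
    finally show ?thesis .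
  qed
  from this[of a] this[of "M (rank a b)"] show ?thesis
    by (cases a; cases "M (rank a b)") auto
qed

lemma head_rank:
  assumes "(a, b) \<in> U"
  shows "head M (rank a b) = b"
  unfolding head_def Lambda_rank[OF assms] rank_level[OF assms]
proof (rule Least_equality)
  show "a < b \<and> level M b \<le> level M b" using U_bounds[OF assms] by simp
next
  fix h assume "a < h \<and> level M b \<le> level M h"
  then show "b \<le> h" using level_less[OF assms, of h] by (meson not_le)
qed

text \<open>The row map is a left inverse of \<open>rank\<close> on \<open>U\<close>. As the ranks
  of the \<open>n\<close> chords lie in \<open>{1..n}\<close>, they exhaust it.\<close>

lemma U_rows: "U = (\<lambda>k. (M k, head M k)) ` {1..n}"
proof -
  let ?r = "\<lambda>(a, b). rank a b" and ?g = "\<lambda>k. (M k, head M k)"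
  have inv: "?g (?r e) = e" if "e \<in> U" for e
    using that Lambda_rank head_rank by (cases e) (auto simp del: insert_iff)
  have "?r ` U \<subseteq> {1..n}"
  proof clarify
    fix a b assume ab: "(a, b) \<in> U"
    have "rank a b \<le> card U"
      unfolding rank_def by (rule card_mono) (auto simp: fin_S below_def)
    then show "rank a b \<in> {1..n}" using rank_pos[OF ab] card_U by simp
  qed
  moreover have "card (?r ` U) = n"
    using card_U card_image[OF inj_on_inverseI[of U ?g ?r]] inv by simp
  ultimately have "?r ` U = {1..n}" by (simp add: card_subset_eq)
  have "?g ` ?r ` U = (\<lambda>e. ?g (?r e)) ` U" by (rule image_image)
  also have "\<dots> = (\<lambda>e. e) ` U" by (rule image_cong[OF refl inv])
  finally show ?thesis unfolding \<open>?r ` U = {1..n}\<close> by (simp only: image_ident)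
qed

lemma row_in_U: "1 \<le> k \<Longrightarrow> k \<le> n \<Longrightarrow> (M k, head M k) \<in> U"
  using U_rows by auto

lemma U_row:
  assumes "(a, b) \<in> U"
  obtains k where "1 \<le> k" "k \<le> n" "M k = a" "head M k = b"
proof -
  have "(a, b) \<in> (\<lambda>k. (M k, head M k)) ` {1..n}" using assms U_rows by blast
  then show ?thesis using that by auto
qed

text \<open>Counting makes the row map injective, so the chord of row \<open>k\<close> has rank
  exactly \<open>k\<close>.\<close>

lemma level_head:
  assumes "1 \<le> k" "k \<le> n"
  shows "level M (head M k) = k + M k"
proof -
  have "card U = card {1..n}" using card_U by simp
  then have inj: "inj_on (\<lambda>k. (M k, head M k)) {1..n}"
    using U_rows by (intro eq_card_imp_inj_on) auto
  let ?j = "rank (M k) (head M k)"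
  have mem: "(M k, head M k) \<in> U" using row_in_U assms by simp
  have "?j \<le> card U"
    unfolding rank_def by (rule card_mono) (auto simp: fin_S below_def)
  then have "?j \<in> {1..n}" using rank_pos[OF mem] card_U by simp
  moreover have "(M ?j, head M ?j) = (M k, head M k)"
    using Lambda_rank[OF mem] head_rank[OF mem] by simp
  ultimately have "?j = k" using inj_onD[OF inj, of ?j k] assms by (simp del: prod.inject)
  then show ?thesis using rank_level[OF mem] by simp
qed

end

lemma Lambda_inj: "1 \<le> n \<Longrightarrow> inj_on Lambda (triangulations n)"
proof (rule inj_onI)
  fix S S' assume n: "1 \<le> n" and "S \<in> triangulations n" "S' \<in> triangulations n"
    and eq: "Lambda S = Lambda S'"
  then interpret a: triangulation n S + b: triangulation n S' by (simp_all add: triangulation_def)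
  have "insert (0, n + 1) S = insert (0, n + 1) S'" using a.U_rows b.U_rows eq by simp
  then show "S = S'" using a.root_notin b.root_notin by (simp add: insert_ident)
qed

text \<open>The set extends to a triangulation, which has no more diagonals than the set
  itself.\<close>

lemma triangulation_if_card:
  assumes "1 \<le> n" "noncrossing n S" "card S = n - 1"
  shows "S \<in> triangulations n"
proof -
  obtain S' where S': "S' \<in> triangulations n" "S \<subseteq> S'"
    using triangulation_extends assms(2) by blast
  interpret triangulation n S' using assms S' by (simp add: triangulation_def)
  have "S = S'" using card_S assms(3) fin_S S'(2) by (simp add: card_subset_eq)
  then show ?thesis using S' by simp
qed

section \<open>Flips\<close>

text \<open>A chord crossing one diagonal of the quadrilateral passes through its interior; since it
  crosses no side, it must end at the two remaining corners.\<close>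

lemma quadrilateral_cross:
  assumes pqrs: "p < q" "q < r" "r < s"
    and "\<not> crossing (p, q) (x, y)" "\<not> crossing (q, r) (x, y)"
    and "\<not> crossing (r, s) (x, y)" "\<not> crossing (p, s) (x, y)"
  shows "crossing (q, s) (x, y) \<Longrightarrow> (x, y) = (p, r)"
    and "crossing (p, r) (x, y) \<Longrightarrow> (x, y) = (q, s)"
proof -
  have pq: "\<not> (p < x \<and> x < q \<and> q < y)" and qr: "\<not> (q < x \<and> x < r \<and> r < y)" "\<not> (x < q \<and> q < y \<and> y < r)"
    and rs: "\<not> (x < r \<and> r < y \<and> y < s)"
    and ps: "\<not> (p < x \<and> x < s \<and> s < y)" "\<not> (x < p \<and> p < y \<and> y < s)"
    using assms(4-7) by (simp_all add: crossing_def)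
  show "(x, y) = (p, r)" if "crossing (q, s) (x, y)"
  proof -
    from that have "x < q \<and> q < y \<and> y < s" using ps(1) pqrs by (auto simp: crossing_def)
    then have "x < q" "q < y" "y < s" by auto
    then have "x = p" "y = r" using pqrs pq qr(2) rs ps(2) by linarith+
    then show ?thesis by simp
  qed
  show "(x, y) = (q, s)" if "crossing (p, r) (x, y)"
  proof -
    from that have "p < x \<and> x < r \<and> r < y" using ps(2) pqrs by (auto simp: crossing_def)
    then have "p < x" "x < r" "r < y" by auto
    then have "x = q" "y = s" using pqrs pq qr(1) rs ps(1) by linarith+
    then show ?thesis by simp
  qed
qed

text \<open>The chords $e$ and $e'$ are the two diagonals of the quadrilateral $p < q < r < s$.\<close>

definition opposite :: "nat \<times> nat \<Rightarrow> nat \<times> nat \<Rightarrow> nat \<Rightarrow> nat \<Rightarrow> nat \<Rightarrow> nat \<Rightarrow> bool" where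
  "opposite e e' p q r s \<longleftrightarrow> p < q \<and> q < r \<and> r < s \<and>
    (e = (p, r) \<and> e' = (q, s) \<or> e = (q, s) \<and> e' = (p, r))"

lemma crossing_sym: "crossing e f \<longleftrightarrow> crossing f e"
  by (auto simp: crossing_def)

lemma opposite_cross: "opposite e e' p q r s \<Longrightarrow> crossing e e'"
  by (auto simp: opposite_def crossing_def)

lemma opposite_sym: "opposite e e' p q r s \<longleftrightarrow> opposite e' e p q r s"
  by (auto simp: opposite_def)

lemma opposite_unique:
  assumes "opposite e e' p q r s" "crossing e f"
    and "\<not> crossing (p, q) f" "\<not> crossing (q, r) f" "\<not> crossing (r, s) f" "\<not> crossing (p, s) f"
  shows "f = e'"
proof -
  obtain x y where f: "f = (x, y)" by (cases f)
  have "p < q" "q < r" "r < s" using assms(1) by (simp_all add: opposite_def)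
  note cross = quadrilateral_cross[OF this assms(3-6)[unfolded f]]
  from assms(1) consider "e = (p, r)" "e' = (q, s)" | "e = (q, s)" "e' = (p, r)"
    by (auto simp: opposite_def)
  then show ?thesis
  proof cases
    case 1
    then have "crossing (p, r) (x, y)" using assms(2) f by simp
    then show ?thesis using cross(2) f 1 by simp
  next
    case 2
    then have "crossing (q, s) (x, y)" using assms(2) f by simp
    then show ?thesis using cross(1) f 2 by simp
  qed
qed

section \<open>The quadrilateral around a diagonal and its exchange\<close>

context triangulation
begin

lemma edge_not_crossing':
  assumes "edge a b" "f \<in> U"
  shows "\<not> crossing (a, b) f"
proof (cases "(a, b) \<in> U")
  case True
  then show ?thesis using U_not_crossing assms(2) by blast
next
  case False
  then have "b = a + 1" using assms(1) unfolding edge_def by blast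
  then show ?thesis by (simp add: crossing_def)
qed

text \<open>This is the triangle on the outer side of the diagonal. Let \<open>(x, y)\<close> be a
  shortest other chord spanning \<open>(a, b)\<close>. Its apex is not strictly between
  \<open>a\<close> and \<open>b\<close>, for then \<open>(a, b)\<close> would cross a side of the
  triangle. By minimality the side of the triangle that spans \<open>(a, b)\<close> is
  \<open>(a, b)\<close> itself.\<close>

lemma parent:
  assumes "(a, b) \<in> S"
  obtains (right) c where "b < c" "(a, c) \<in> U" "edge b c"
  | (left) c where "c < a" "(c, b) \<in> U" "edge c a"
proof -
  let ?P = "\<lambda>e. e \<in> U \<and> fst e \<le> a \<and> b \<le> snd e \<and> e \<noteq> (a, b)"
  have "?P (0, n + 1)" using assms root_notin U_bounds[of a b] by auto
  then obtain e where e: "?P e" and min: "\<And>f. ?P f \<Longrightarrow> snd e - fst e \<le> snd f - fst f"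
    using ex_has_least_nat[of ?P _ "\<lambda>e. snd e - fst e"] by blast
  obtain x y where xy: "e = (x, y)" by (cases e)
  with e have U: "(x, y) \<in> U" "x \<le> a" "b \<le> y" "(x, y) \<noteq> (a, b)" by auto
  have ab: "(a, b) \<in> U" "a + 1 < b" using assms U_bounds by auto
  obtain d where d: "x < d" "d < y" "edge x d" "edge d y" using U(1) by (rule apex)
  consider "b \<le> d" | "d \<le> a" | "a < d" "d < b" by linarith
  then show ?thesis
  proof cases
    case 1
    then have "(x, d) \<in> U" using d U ab by (auto simp: edge_def)
    then have "(x, d) = (a, b) \<or> y - x \<le> d - x" using min[of "(x, d)"] U 1 xy by auto
    then have "(x, d) = (a, b)" using d by linarith
    then show ?thesis using right[of y] d U by auto
  next
    case 2
    then have "(d, y) \<in> U" using d U ab by (auto simp: edge_def)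
    then have "(d, y) = (a, b) \<or> y - x \<le> y - d" using min[of "(d, y)"] U 2 xy by auto
    then have "(d, y) = (a, b)" using d by linarith
    then show ?thesis using left[of x] d U by auto
  next
    case 3
    then have "(x, y) = (a, b)"
      using edge_not_crossing[OF d(3) ab(1)] edge_not_crossing[OF d(4) ab(1)] U by auto
    then show ?thesis using U by simp
  qed
qed

text \<open>The level of \<open>n + 1\<close> is \<open>n\<close>, so the root
  \<open>(0, n + 1)\<close> occupies row \<open>n\<close> and the diagonals occupy the rows before
  it.\<close>

lemma row_root: "M n = 0" "head M n = n + 1"
  and S_rows: "S = (\<lambda>k. (M k, head M k)) ` {1..<n}"
proof -
  let ?g = "\<lambda>k. (M k, head M k)"
  have "{e \<in> U. n + 1 \<le> fst e} = {}" using U_bounds by fastforce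
  then have "rows_ge M (n + 1) = 0" using rows_ge_U[of "n + 1"] by (metis card.empty le_add2)
  then have lev: "level M (n + 1) = n" by (simp add: level_def)
  have root: "k = n" if "1 \<le> k" "k \<le> n" "M k = 0" "head M k = n + 1" for k
    using level_head[of k] that lev by simp
  moreover obtain k where "1 \<le> k" "k \<le> n" "M k = 0" "head M k = n + 1"
    by (rule U_row[of 0 "n + 1"]) auto
  ultimately show n: "M n = 0" "head M n = n + 1" by auto
  have "{1..n} = insert n {1..<n}" using n_pos by auto
  then have "insert (0, n + 1) S = insert (0, n + 1) (?g ` {1..<n})" using U_rows n by simp
  moreover have "(0, n + 1) \<notin> ?g ` {1..<n}" using root by fastforce
  ultimately show "S = ?g ` {1..<n}" using root_notin by (simp add: insert_ident)
qed

lemma row_in_S: "1 \<le> k \<Longrightarrow> k < n \<Longrightarrow> (M k, head M k) \<in> S"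
  by (rule equalityD2[OF S_rows, THEN subsetD]) auto

lemma Lambda_antimono: "1 \<le> i \<Longrightarrow> i \<le> j \<Longrightarrow> M j \<le> M i"
  using young_antimono young_Lambda fin_S by blast

text \<open>
  Here the triangles on both sides of the diagonal are $(a, d, b)$ and $(a, b, c)$. The maximum in
  the definition of the flip is the row of $(d, b)$, or, if this chord is a side, the last
  row of length at least $b$.
\<close>

lemma flip_length_right:
  assumes k: "1 \<le> k" "k \<le> n" and ab: "M k = a" "head M k = b"
    and c: "b < c" "(a, c) \<in> U"
    and d: "a < d" "d < b" "edge a d" "edge d b"
  shows "flip_length M k = d"
proof -
  have abU: "(a, b) \<in> U" using row_in_U[OF k] ab by simp
  have level_b: "level M b = k + a" using level_head[OF k] ab by simp
  have next_row: "M (k + 1) = M k"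
  proof -
    \<comment> \<open>The chord \<open>(a, c)\<close> has the same tail and a larger level, so it is
      a later row of the same length. By monotonicity row \<open>k + 1\<close> has this length too,
      which selects the first case of the flip.\<close>
    obtain j where j: "1 \<le> j" "j \<le> n" "M j = a" "head M j = c" using c(2) by (rule U_row)
    have "k + a < j + a" using level_less[OF c(2) _ c(1)] level_head[OF j(1,2)] j level_b d by simp
    then show ?thesis using Lambda_antimono[of "k + 1" j] Lambda_antimono[of k "k + 1"] j ab k by simp
  qed
  let ?T = "{m. 1 \<le> m \<and> m < k \<and> k + M k \<le> m + M m}"
  \<comment> \<open>Chosen to make \<open>m0 + d\<close> the level of \<open>b\<close>. The value 0
    occurs when the set in the definition is empty.\<close>
  define m0 where "m0 = k + a - d"
  have "d \<le> k + a" using level_b d by (simp add: level_def)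
  then have m0: "m0 + d = k + a" "m0 < k" using d k by (auto simp: m0_def)
  have m0_T: "(m0 = 0 \<or> m0 \<in> ?T) \<and> (\<forall>m>m0. m < k \<longrightarrow> M m < b)"
  proof (cases "b = d + 1")
    case True
    then have rows: "m0 = rows_ge M b" using level_b m0 by (simp add: level_def)
    have ge: "b \<le> M m \<longleftrightarrow> m \<le> m0" if "1 \<le> m" for m
      using young_ge_iff[OF young_Lambda[OF fin_S] that] True rows by simp
    show ?thesis
    proof (intro conjI allI impI)
      show "m0 = 0 \<or> m0 \<in> ?T" using ge[of m0] m0 True ab by (cases "m0 = 0") auto
      fix m assume "m0 < m" "m < k"
      then show "M m < b" using ge[of m] by simp
    qed
  next
    case False
    then have "(d, b) \<in> U" using d by (simp add: edge_def)
    then obtain j where j: "1 \<le> j" "j \<le> n" "M j = d" "head M j = b" by (rule U_row)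
    then have "j = m0" using level_head[OF j(1,2)] level_b m0 by simp
    then have "1 \<le> m0" "M m0 = d" using j by auto
    moreover have "M m \<le> d" if "m0 < m" for m
      using Lambda_antimono[of m0 m] that \<open>1 \<le> m0\<close> \<open>M m0 = d\<close> by simp
    ultimately show ?thesis using m0 d ab by (auto intro: le_less_trans)
  qed
  \<comment> \<open>Such a row with tail \<open>x\<close> other than \<open>a\<close> has
    \<open>a < x < b\<close>, so its head is at most \<open>b\<close>. Head \<open>b\<close> would
    force \<open>x < d\<close>, and the chord would cross \<open>(a, d)\<close>. So its head has a
    smaller level than \<open>b\<close>.\<close>
  have between: "m + M m < k + a" if m: "m0 < m" "m < k" for m
  proof -
    define x y where "x = M m" and "y = head M m"
    have mem: "(x, y) \<in> U" and lev: "m + x = level M y"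
      using row_in_U[of m] level_head[of m] m k by (auto simp: x_def y_def)
    have "a \<le> x" using Lambda_antimono[of m k] m ab by (simp add: x_def)
    have "x < b" using m0_T m by (simp add: x_def)
    show ?thesis
    proof (cases "x = a")
      case True
      then show ?thesis using m by (simp add: x_def)
    next
      case False
      then have "y \<le> b"
        using edge_not_crossing(1)[OF U_edge[OF abU] mem] \<open>a \<le> x\<close> \<open>x < b\<close> by auto
      moreover have "y \<noteq> b"
      proof
        assume "y = b"
        then have "x < d" using lev level_b m0 m by simp
        then show False
          using edge_not_crossing(1)[OF d(3) mem] \<open>y = b\<close> False \<open>a \<le> x\<close> d by auto
      qed
      ultimately have "level M y < level M b"
        using level_less[OF abU, of y] U_bounds[OF mem] \<open>a \<le> x\<close> by simp
      then show ?thesis using lev level_b by (simp add: x_def)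
    qed
  qed
  show ?thesis
  proof (cases "m0 = 0")
    case True
    \<comment> \<open>The default value \<open>k + M k\<close> of the definition is then
      \<open>d\<close>.\<close>
    have "m \<notin> ?T" for m using between[of m] True ab by auto
    then have "?T = {}" by blast
    then show ?thesis using next_row m0 True ab by (simp add: flip_length_def)
  next
    case False
    then have "m0 \<in> ?T" using m0_T by simp
    moreover have "m \<le> m0" if "m \<in> ?T" for m
      using between[of m] that ab by (auto simp: not_less[symmetric])
    moreover have "finite ?T" by (rule finite_subset[of _ "{..k}"]) auto
    ultimately have "Max ?T = m0" "?T \<noteq> {}" by (auto intro: Max_eqI)
    then show ?thesis using next_row m0 ab by (simp add: flip_length_def Let_def)
  qed
qed

text \<open>Here the outer triangle is $(c, a, b)$, and the minimum is the row of the chord $(c, b)$.\<close>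

lemma flip_length_left:
  assumes k: "1 \<le> k" "k \<le> n" and ab: "M k = a" "head M k = b"
    and c: "c < a" "(c, b) \<in> U" "edge c a"
  shows "flip_length M k = c"
proof -
  have abU: "(a, b) \<in> U" using row_in_U[OF k] ab by simp
  then have "a < b" using U_bounds by fastforce
  have level_b: "level M b = k + a" using level_head[OF k] ab by simp
  \<comment> \<open>Rows \<open>k\<close> and \<open>m0\<close> end at the same vertex, so they have
    the same sum of index and length; the shorter row comes later.\<close>
  obtain m0 where m0: "1 \<le> m0" "m0 \<le> n" "M m0 = c" "head M m0 = b" using c(2) by (rule U_row)
  have m0_eq: "m0 + c = k + a" using level_head[OF m0(1,2)] level_b m0 by simp
  then have "k < m0" using c by simp
  let ?T = "{m. m > k \<and> k + M k \<le> m + M m}"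
  \<comment> \<open>A later chord with tail \<open>a\<close> would end beyond \<open>b\<close> and
    cross \<open>(c, b)\<close>. A tail strictly between \<open>c\<close> and \<open>a\<close>
    forces a head below \<open>b\<close>, because head \<open>b\<close> would cross
    \<open>(c, a)\<close>; then the level is smaller.\<close>
  have less: "M m < a \<and> m + M m < k + a" if m: "k < m" "m < m0" for m
  proof -
    define x y where "x = M m" and "y = head M m"
    have mem: "(x, y) \<in> U" and lev: "m + x = level M y"
      using row_in_U[of m] level_head[of m] m k m0 by (auto simp: x_def y_def)
    have "x \<le> a" using Lambda_antimono[of k m] m k ab by (simp add: x_def)
    have "c \<le> x" using Lambda_antimono[of m m0] m m0 by (simp add: x_def)
    have "x \<noteq> a"
    proof
      assume "x = a"
      then have "level M b < level M y" using lev level_b m by simp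
      then have "b < y" using level_less[OF abU, of y] U_bounds[OF mem] \<open>x = a\<close>
        by (metis add_lessD1 less_asym linorder_neqE_nat nat_less_le)
      then show False
        using edge_not_crossing(1)[OF U_edge[OF c(2)] mem] \<open>x = a\<close> c \<open>a < b\<close> by simp
    qed
    then have "x < a" using \<open>x \<le> a\<close> by simp
    moreover have "m + x < k + a"
    proof (cases "x = c")
      case True
      then show ?thesis using m m0_eq by simp
    next
      case False
      then have "c < x" using \<open>c \<le> x\<close> by simp
      then have "y \<le> b" "y \<noteq> b"
        using edge_not_crossing(1)[OF U_edge[OF c(2)] mem] edge_not_crossing(1)[OF c(3) mem]
          \<open>x < a\<close> \<open>a < b\<close> by auto
      then have "level M y < level M b"
        using level_less[OF c(2), of y] U_bounds[OF mem] \<open>c < x\<close> by simp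
      then show ?thesis using lev level_b by simp
    qed
    ultimately show ?thesis by (simp add: x_def)
  qed
  have "M (k + 1) \<noteq> M k"
  proof (cases "k + 1 = m0")
    case True
    then show ?thesis using m0 ab c by simp
  next
    case False
    then show ?thesis using less[of "k + 1"] \<open>k < m0\<close> ab by simp
  qed
  moreover have "m0 \<in> ?T" using m0 m0_eq \<open>k < m0\<close> ab by simp
  then have "?T \<noteq> {}" by blast
  moreover have "Inf ?T = m0"
  proof (rule cInf_eq_minimum)
    show "m0 \<in> ?T" by fact
    show "m0 \<le> m" if "m \<in> ?T" for m using less[of m] that ab by (fastforce simp: not_less[symmetric])
  qed
  ultimately show ?thesis using m0_eq ab by (simp add: flip_length_def Let_def)
qed

text \<open>The inner triangle has apex \<open>d\<close>, the outer one has third vertex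
  \<open>c\<close>. The opposite diagonal joins \<open>d\<close> and \<open>c\<close>; its tail is
  \<open>d\<close> if \<open>c\<close> lies to the right and \<open>c\<close> if it lies to the
  left.\<close>

lemma row_quadrilateral:
  assumes "1 \<le> k" "k < n"
  obtains e' p q r s where "opposite (M k, head M k) e' p q r s"
    "edge p q" "edge q r" "edge r s" "edge p s" "fst e' = flip_length M k"
proof -
  define a b where "a = M k" and "b = head M k"
  have "(a, b) \<in> S"
    unfolding a_def b_def by (rule row_in_S[OF assms])
  then have "(a, b) \<in> U" by simp
  then obtain d where d: "a < d" "d < b" "edge a d" "edge d b" by (rule apex)
  from \<open>(a, b) \<in> S\<close> show ?thesis
  proof (cases rule: parent)
    case (right c)
    have "flip_length M k = d"
      by (rule flip_length_right[OF _ _ _ _ right(1,2) d]) (use assms a_def b_def in auto)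
    then show ?thesis
      using that[of "(d, c)" a d b c] right d U_edge by (simp add: opposite_def a_def b_def)
  next
    case (left c)
    have "flip_length M k = c"
      by (rule flip_length_left[OF _ _ _ _ left]) (use assms a_def b_def in auto)
    then show ?thesis
      using that[of "(c, d)" c a d b] left d U_edge by (simp add: opposite_def a_def b_def)
  qed
qed

text \<open>Among the chords present only \<open>e\<close> can cross \<open>e'\<close>, and the
  exchange preserves the number of diagonals.\<close>

lemma flip_triangulation:
  assumes e: "e \<in> S" and opp: "opposite e e' p q r s"
    and sides: "edge p q" "edge q r" "edge r s" "edge p s"
  shows "e' \<notin> S" "insert e' (S - {e}) \<in> triangulations n"
proof -
  show notin: "e' \<notin> S" using e U_not_crossing opposite_cross[OF opp] by blast
  have nc: "\<not> crossing e' f" if "f \<in> S - {e}" for f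
    using opposite_unique[of e' e p q r s f] opp opposite_sym sides edge_not_crossing' that
    by blast
  have "(p, s) \<in> U" using sides(4) opp by (auto simp: opposite_def edge_def)
  then have "e' \<in> diagonals n"
    using opp U_bounds[of p s] by (auto simp: opposite_def diagonals_def)
  moreover have "\<not> crossing e' e'" by (simp add: crossing_def)
  ultimately have "noncrossing n (insert e' (S - {e}))"
    using nc crossing_sym S_diagonals U_not_crossing unfolding noncrossing_def by blast
  moreover have "card (insert e' (S - {e})) = n - 1"
    using notin e fin_S card_S by (metis card.remove card_insert_disjoint finite_Diff Diff_iff)
  ultimately show "insert e' (S - {e}) \<in> triangulations n"
    using triangulation_if_card n_pos by blast
qed

text \<open>Only \<open>e\<close> is lost, so the sides of the quadrilateral remain edges and
  \<open>f\<close> crosses none of them. If \<open>f\<close> did not cross \<open>e\<close>, it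
  could be added to the maximal set \<open>S\<close>.\<close>

lemma flip_unique:
  assumes e: "e \<in> S" and opp: "opposite e e' p q r s"
    and sides: "edge p q" "edge q r" "edge r s" "edge p s"
    and S': "S' \<in> triangulations n" "S - S' = {e}" "f \<in> S' - S"
  shows "f = e'"
proof -
  interpret S': triangulation n S' using S' n_pos by (simp add: triangulation_def)
  have f_S: "f \<in> U \<longrightarrow> f \<in> S" using S' S'.root_notin by auto
  have edge': "S'.edge a b" if "edge a b" "(a, b) \<noteq> e" for a b
    using that S'(2) by (auto simp: edge_def S'.edge_def)
  have "(p, q) \<noteq> e" "(q, r) \<noteq> e" "(r, s) \<noteq> e" "(p, s) \<noteq> e"
    using opp by (auto simp: opposite_def)
  then have sides': "\<not> crossing (p, q) f" "\<not> crossing (q, r) f" "\<not> crossing (r, s) f" "\<not> crossing (p, s) f"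
    using S'.edge_not_crossing' edge' sides S'(3) by blast+
  have "crossing e f"
  proof (rule ccontr)
    assume not: "\<not> crossing e f"
    have nc: "\<not> crossing f g" if "g \<in> S" for g
    proof (cases "g = e")
      case True
      then show ?thesis using not crossing_sym by blast
    next
      case False
      then have "g \<in> S'" using S'(2) that by blast
      then show ?thesis using S'.U_not_crossing S'(3) by blast
    qed
    have "f \<in> U"
      using U_maximal[of "fst f" "snd f"] S'.U_bounds[of "fst f" "snd f"] S'(3) nc by auto
    then show False using f_S S'(3) by blast
  qed
  then show ?thesis using opposite_unique[OF opp] sides' by blast
qed

text \<open>Both sides are sorted, so it suffices to compare column lengths. These agree before the
  exchange, and both then lose an entry of size \<open>M k\<close> and gain one of size
  \<open>flip_length M k\<close>.\<close>

lemma row_flip_eq: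
  assumes k: "1 \<le> k" "k < n" and e': "fst e' = flip_length M k" "e' \<notin> S"
  shows "row_flip M k = Lambda (insert e' (S - {(M k, head M k)}))"
proof -
  let ?e = "(M k, head M k)" and ?l = "flip_length M k"
  let ?f = "M(k := ?l)" and ?S' = "insert e' (S - {(M k, head M k)})"
  have e: "?e \<in> S" by (rule row_in_S[OF k])
  have finM: "finite {j. M j \<noteq> 0}" using young_Lambda[OF fin_S] by (simp add: young_diagram_def)
  have fin: "finite {j. ?f j \<noteq> 0}"
    by (rule finite_subset[of _ "insert k {j. M j \<noteq> 0}"]) (use finM in auto)
  have rows: "rows_ge ?f t = card {x \<in> ?S'. t \<le> fst x}" if "1 \<le> t" for t
  proof -
    let ?R = "{m. 1 \<le> m \<and> t \<le> M m}" and ?C = "{x \<in> S. t \<le> fst x}"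
    have R: "{m. 1 \<le> m \<and> t \<le> ?f m} = (if t \<le> ?l then insert k (?R - {k}) else ?R - {k})"
      using k by auto
    have C: "{x \<in> ?S'. t \<le> fst x} = (if t \<le> ?l then insert e' (?C - {?e}) else ?C - {?e})"
      using e' by auto
    have fins: "finite ?R" "finite ?C" using finite_rows_ge[OF finM that] fin_S by auto
    have "card ?R = card ?C" using rows_ge_Lambda[OF fin_S that] by (simp add: rows_ge_def)
    moreover have "k \<in> ?R \<longleftrightarrow> ?e \<in> ?C" using k e by auto
    ultimately have eq: "card (?R - {k}) = card (?C - {?e})" by (simp add: card_Diff_singleton_if)
    have notin: "e' \<notin> ?C - {?e}" "k \<notin> ?R - {k}" using e' by auto
    have "card (insert k (?R - {k})) = card (insert e' (?C - {?e}))"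
      unfolding card_insert_disjoint[OF finite_Diff[OF fins(1)] notin(2)]
        card_insert_disjoint[OF finite_Diff[OF fins(2)] notin(1)] eq ..
    with eq show ?thesis unfolding rows_ge_def R C by presburger
  qed
  show ?thesis
  proof (rule eq_if_ge_iff)
    show "row_flip M k 0 = Lambda ?S' 0"
      by (simp add: row_flip_def reorder_def Lambda_def sorted_rows_0)
    fix j t :: nat assume "1 \<le> j" "1 \<le> t"
    then show "t \<le> row_flip M k j \<longleftrightarrow> t \<le> Lambda ?S' j"
      unfolding row_flip_def
      by (subst reorder_ge_iff[OF fin], simp_all only:)
        (subst Lambda_ge_iff, use fin_S rows in auto)
  qed
qed

end

section \<open>The triangulation of a diagram\<close>

definition rows_tri :: "nat \<Rightarrow> (nat \<Rightarrow> nat) \<Rightarrow> (nat \<times> nat) set" where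
  "rows_tri n M = (\<lambda>k. (M k, head M k)) ` {1..<n}"

lemma Y_young: "M \<in> Y n \<Longrightarrow> young_diagram M"
  by (simp add: Y_def)

lemma Y_bound:
  assumes "M \<in> Y n" "1 \<le> k" "k \<le> n"
  shows "k + M k \<le> n"
  using assms by (cases "k = n") (auto simp: Y_def)

lemma Y_zero: "M \<in> Y n \<Longrightarrow> n \<le> k \<Longrightarrow> M k = 0"
  by (simp add: Y_def)

text \<open>A discrete continuity: since levels rise by at most one per step, the first vertex
  reaching a value attains it exactly.\<close>

lemma level_Suc_le:
  assumes "young_diagram M" "1 \<le> b"
  shows "level M (b + 1) \<le> level M b + 1"
proof -
  have "finite {m. 1 \<le> m \<and> b \<le> M m}"
    using finite_rows_ge assms unfolding young_diagram_def by blast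
  then have "rows_ge M (b + 1) \<le> rows_ge M b"
    unfolding rows_ge_def by (rule card_mono) auto
  then show ?thesis using assms by (simp add: level_def)
qed

lemma level_le:
  assumes "M \<in> Y n" "1 \<le> b" "b \<le> n"
  shows "level M b \<le> n - 1"
proof -
  have "{m. 1 \<le> m \<and> b \<le> M m} \<subseteq> {1..n - b}"
  proof
    fix m assume m: "m \<in> {m. 1 \<le> m \<and> b \<le> M m}"
    then have "m \<le> n" using Y_zero[OF assms(1), of m] assms by (cases "m \<le> n") auto
    then show "m \<in> {1..n - b}" using m Y_bound[OF assms(1), of m] by auto
  qed
  then have "rows_ge M b \<le> n - b" unfolding rows_ge_def
    using card_mono[OF finite_atLeastAtMost, of _ 1 "n - b"] by simp
  then show ?thesis using assms by (simp add: level_def)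
qed

lemma level_top:
  assumes "M \<in> Y n"
  shows "level M (n + 1) = n"
proof -
  have "M m \<le> n" if "1 \<le> m" for m
    using Y_bound[OF assms that] Y_zero[OF assms, of m] by (cases "m \<le> n") auto
  then have "{m. 1 \<le> m \<and> n + 1 \<le> M m} = {}" by fastforce
  then have "rows_ge M (n + 1) = 0" unfolding rows_ge_def by (simp only: card.empty)
  then show ?thesis by (simp add: level_def)
qed

lemma head_props:
  assumes "M \<in> Y n" "1 \<le> k" "k \<le> n"
  shows "M k + 1 < head M k" "head M k \<le> n + 1" "level M (head M k) = k + M k"
    and "M k < h \<Longrightarrow> h < head M k \<Longrightarrow> level M h < k + M k"
proof -
  let ?P = "\<lambda>b. M k < b \<and> k + M k \<le> level M b"
  have top: "?P (n + 1)" using level_top[OF assms(1)] Y_bound[OF assms] assms(2) by simp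
  have P: "?P (head M k)" unfolding head_def by (rule LeastI[of ?P, OF top])
  show "head M k \<le> n + 1" unfolding head_def by (rule Least_le[of ?P, OF top])
  show less: "level M h < k + M k" if "M k < h" "h < head M k" for h
    using not_less_Least[of h ?P] that unfolding head_def by auto
  \<comment> \<open>Row \<open>k\<close> is too short to count here, so the level at
    \<open>M k + 1\<close> is too small and the head is not the neighbouring vertex.\<close>
  have "rows_ge M (M k + 1) < k"
    using young_ge_iff[OF Y_young[OF assms(1)] assms(2), of "M k + 1"] by simp
  then have "level M (M k + 1) < k + M k" by (simp add: level_def)
  with P show gt: "M k + 1 < head M k"
    by (metis Suc_eq_plus1 Suc_lessI not_less)
  then have "level M (head M k - 1) < k + M k" "1 \<le> head M k - 1"
    using less[of "head M k - 1"] by simp_all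
  then show "level M (head M k) = k + M k"
    using level_Suc_le[OF Y_young[OF assms(1)], of "head M k - 1"] gt P by simp
qed

lemma head_top:
  assumes "M \<in> Y n" "1 \<le> n"
  shows "M n = 0" "head M n = n + 1"
proof -
  show "M n = 0" by (rule Y_zero[OF assms(1) order_refl])
  show "head M n = n + 1"
  proof (rule ccontr)
    assume "head M n \<noteq> n + 1"
    then have "level M (head M n) \<le> n - 1"
      using level_le[OF assms(1)] head_props(1,2)[OF assms order_refl] by simp
    then show False using head_props(3)[OF assms order_refl] assms(2) by linarith
  qed
qed

lemma rows_tri_Suc:
  assumes "M \<in> Y n" "1 \<le> n"
  shows "rows_tri (n + 1) M = insert (0, n + 1) (rows_tri n M)"
proof -
  have "{1..<n + 1} = insert n {1..<n}" using assms(2) by auto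
  then show ?thesis using head_top[OF assms] by (simp add: rows_tri_def)
qed

lemma rows_inj:
  assumes "M \<in> Y n"
  shows "inj_on (\<lambda>k. (M k, head M k)) {1..<n}"
proof (rule inj_onI)
  fix i j assume ij: "i \<in> {1..<n}" "j \<in> {1..<n}" "(M i, head M i) = (M j, head M j)"
  have lev: "level M (head M k) = k + M k" if "k \<in> {1..<n}" for k
    using head_props(3)[OF assms, of k] that by simp
  have "M i = M j" "head M i = head M j" using ij(3) by simp_all
  then have "i + M j = j + M j" using lev[OF ij(1)] lev[OF ij(2)] by (simp only:)
  then show "i = j" by simp
qed

lemma rows_tri_triangulation:
  assumes M: "M \<in> Y n" and n: "1 \<le> n"
  shows "rows_tri n M \<in> triangulations n"
proof (rule triangulation_if_card[OF n])
  show "card (rows_tri n M) = n - 1"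
    unfolding rows_tri_def card_image[OF rows_inj[OF M]] by simp
  have "(M k, head M k) \<in> diagonals n" if "k \<in> {1..<n}" for k
  proof -
    have "head M k \<noteq> n + 1" if "M k = 0"
      using head_props(3)[OF M, of k] level_top[OF M] \<open>k \<in> {1..<n}\<close> that by auto
    then show ?thesis
      using head_props(1,2)[OF M, of k] \<open>k \<in> {1..<n}\<close> by (auto simp: diagonals_def)
  qed
  moreover have "\<not> (M i < M j \<and> M j < head M i \<and> head M i < head M j)"
    if "i \<in> {1..<n}" "j \<in> {1..<n}" for i j
  proof
    \<comment> \<open>Row \<open>j\<close> itself is counted at \<open>M j\<close>, so
      \<open>j + M j\<close> exceeds the level of \<open>M j\<close> by at most one and is at most
      \<open>i + M i\<close>. But \<open>head M i\<close> lies strictly between \<open>M j\<close>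
      and \<open>head M j\<close>, so its level \<open>i + M i\<close> is below
      \<open>j + M j\<close>.\<close>
    assume *: "M i < M j \<and> M j < head M i \<and> head M i < head M j"
    have "level M (M j) < i + M i" using head_props(4)[OF M, of i "M j"] * that by simp
    moreover have "j \<le> rows_ge M (M j)"
      using young_ge_iff[OF Y_young[OF M], of j "M j"] * that by auto
    then have "j + M j \<le> level M (M j) + 1" using * by (simp add: level_def)
    moreover have "level M (head M i) < j + M j"
      using head_props(4)[OF M, of j "head M i"] * that by simp
    moreover have "level M (head M i) = i + M i" using head_props(3)[OF M, of i] that by simp
    ultimately show False by simp
  qed
  ultimately show "noncrossing n (rows_tri n M)"
    by (auto simp: noncrossing_def rows_tri_def crossing_def)
qed

lemma Lambda_rows_tri:
  assumes M: "M \<in> Y n"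
  shows "Lambda (rows_tri n M) = M"
proof (rule eq_if_ge_iff)
  show "Lambda (rows_tri n M) 0 = M 0"
    using Y_young[OF M] by (simp add: Lambda_def sorted_rows_0 young_diagram_def)
  fix k t :: nat assume kt: "1 \<le> k" "1 \<le> t"
  let ?g = "\<lambda>k. (M k, head M k)" and ?R = "{m. 1 \<le> m \<and> t \<le> M m}"
  \<comment> \<open>Rows from \<open>n\<close> on are zero, so for positive \<open>t\<close> no row
    is missed by \<open>rows_tri\<close>.\<close>
  have sub: "?R \<subseteq> {1..<n}"
  proof
    fix m assume "m \<in> ?R"
    then show "m \<in> {1..<n}" using Y_zero[OF M, of m] kt by (cases "m < n") auto
  qed
  have "{e \<in> rows_tri n M. t \<le> fst e} = ?g ` ?R"
    using sub by (auto simp: rows_tri_def)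
  then have "card {e \<in> rows_tri n M. t \<le> fst e} = rows_ge M t"
    unfolding rows_ge_def using card_image[OF inj_on_subset[OF rows_inj[OF M] sub]] by simp
  then show "t \<le> Lambda (rows_tri n M) k \<longleftrightarrow> t \<le> M k"
    using Lambda_ge_iff[OF _ kt, of "rows_tri n M"] young_ge_iff[OF Y_young[OF M] kt]
    by (simp add: rows_tri_def)
qed

lemma triangulation_of_Lambda:
  "1 \<le> n \<Longrightarrow> S \<in> triangulations n \<Longrightarrow> triangulation_of n (Lambda S) = S"
  by (simp add: triangulation_of_def the_inv_into_f_f Lambda_inj)

lemma triangulation_of_eq: "M \<in> Y n \<Longrightarrow> 1 \<le> n \<Longrightarrow> triangulation_of n M = rows_tri n M"
  using triangulation_of_Lambda[OF _ rows_tri_triangulation] Lambda_rows_tri by simp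

section \<open>Independence of the size of the polygon\<close>

lemma Y_Suc:
  assumes "M \<in> Y n"
  shows "M \<in> Y (Suc n)"
  using assms Y_bound[OF assms] by (fastforce simp: Y_def)

text \<open>Both triangulations gain the same diagonal \<open>(0, n + 1)\<close>, so their
  differences do not change.\<close>

lemma n_flip_Suc:
  assumes "A \<in> Y n" "B \<in> Y n" "1 \<le> n"
  shows "n_flip (Suc n) A B \<longleftrightarrow> n_flip n A B"
proof -
  have "(0, n + 1) \<notin> rows_tri n M" if "M \<in> Y n" for M
  proof -
    interpret triangulation n "rows_tri n M"
      using rows_tri_triangulation that assms(3) by (simp add: triangulation_def)
    show ?thesis by (rule root_notin)
  qed
  then have "insert (0, n + 1) (rows_tri n A) - insert (0, n + 1) (rows_tri n B) = rows_tri n A - rows_tri n B"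
    "insert (0, n + 1) (rows_tri n B) - insert (0, n + 1) (rows_tri n A) = rows_tri n B - rows_tri n A"
    using assms by blast+
  then show ?thesis
    using assms Y_Suc triangulation_of_eq rows_tri_Suc[OF assms(1,3)] rows_tri_Suc[OF assms(2,3)]
    by (simp add: n_flip_def)
qed

lemma n_flip_mono:
  assumes "n \<le> N" "A \<in> Y n" "B \<in> Y n" "1 \<le> n"
  shows "A \<in> Y N \<and> B \<in> Y N \<and> (n_flip N A B \<longleftrightarrow> n_flip n A B)"
  using assms(1)
proof (induction N rule: dec_induct)
  case (step m)
  then show ?case using Y_Suc n_flip_Suc[of A m B] assms(4) by simp
qed (use assms in simp)

lemma young_in_Y:
  assumes "young_diagram M"
  obtains N where "\<And>n. N \<le> n \<Longrightarrow> M \<in> Y n"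
proof -
  obtain K where K: "\<And>k. M k \<noteq> 0 \<Longrightarrow> k < K"
    using assms finite_nat_set_iff_bounded by (auto simp: young_diagram_def)
  have "M \<in> Y n" if "K + M 1 \<le> n" for n
  proof -
    have "M k \<le> n - k" if "1 \<le> k" for k
      using K[of k] young_antimono[OF assms _ that] \<open>K + M 1 \<le> n\<close>
      by (cases "M k = 0") auto
    moreover have "M k = 0" if "n \<le> k" for k using K[of k] \<open>K + M 1 \<le> n\<close> that by auto
    ultimately show ?thesis using assms by (simp add: Y_def)
  qed
  then show ?thesis using that by blast
qed

section \<open>Row flips and flips of triangulations\<close>

lemma n_flip_row_flip:
  assumes A: "A \<in> Y n" and k: "1 \<le> k" "k < n"
  shows "n_flip n A (row_flip A k)"
proof -
  define S where "S = rows_tri n A"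
  interpret triangulation n S
    using rows_tri_triangulation[OF A] k by (simp add: triangulation_def S_def)
  have L: "Lambda S = A" using Lambda_rows_tri[OF A] by (simp add: S_def)
  let ?e = "(A k, head A k)"
  have e: "?e \<in> S" using k by (simp add: S_def rows_tri_def)
  obtain e' p q r s where quad: "opposite ?e e' p q r s"
    "edge p q" "edge q r" "edge r s" "edge p s" "fst e' = flip_length A k"
    using row_quadrilateral[OF k] unfolding L by blast
  note flip = flip_triangulation[OF e quad(1-5)]
  have "row_flip A k = Lambda (insert e' (S - {?e}))"
    using row_flip_eq[OF k, of e'] quad(6) flip(1) unfolding L by blast
  then have B: "triangulation_of n (row_flip A k) = insert e' (S - {?e})"
    using triangulation_of_Lambda flip(2) k by simp
  have "S - insert e' (S - {?e}) = {?e}" "insert e' (S - {?e}) - S = {e'}"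
    using e flip(1) by auto
  then show ?thesis
    using B triangulation_of_eq[OF A] k by (simp add: n_flip_def S_def)
qed

lemma row_flip_if_n_flip:
  assumes A: "A \<in> Y n" and B: "B \<in> Y n" and n: "1 \<le> n" and flip: "n_flip n A B"
  obtains k where "1 \<le> k" "B = row_flip A k"
proof -
  define S S' where "S = rows_tri n A" and "S' = rows_tri n B"
  interpret triangulation n S
    using rows_tri_triangulation[OF A n] n by (simp add: triangulation_def S_def)
  have L: "Lambda S = A" "Lambda S' = B"
    using Lambda_rows_tri A B by (simp_all add: S_def S'_def)
  obtain e f where ef: "S - S' = {e}" "S' - S = {f}"
    using flip triangulation_of_eq A B n unfolding n_flip_def S_def S'_def
    by (auto simp: card_1_singleton_iff)
  then have e: "e \<in> S" by blast
  then obtain k where k: "1 \<le> k" "k < n" "e = (A k, head A k)"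
    by (auto simp: S_def rows_tri_def)
  obtain e' p q r s where quad: "opposite e e' p q r s"
    "edge p q" "edge q r" "edge r s" "edge p s" "fst e' = flip_length A k"
    using row_quadrilateral[OF k(1,2)] unfolding L k(3) by blast
  have "f = e'"
    by (rule flip_unique[OF e quad(1-5) _ ef(1)])
      (use rows_tri_triangulation[OF B n] ef(2) in \<open>auto simp: S'_def\<close>)
  then have "S' = insert e' (S - {e})" using ef by blast
  moreover have "e' \<notin> S" using flip_triangulation(1)[OF e quad(1-5)] .
  ultimately have "B = row_flip A k"
    using row_flip_eq[OF k(1,2), of e'] quad(6) L k(3) by metis
  then show ?thesis using that k(1) by blast
qed

theorem theorem2:
  fixes A B :: "nat \<Rightarrow> nat"
  assumes "young_diagram A" and "young_diagram B"
  shows "(\<exists>k\<ge>1. B = row_flip A k) \<longleftrightarrow>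
    (\<forall>n\<ge>1. A \<in> Y n \<and> B \<in> Y n \<longrightarrow> n_flip n A B)"
proof
  assume "\<exists>k\<ge>1. B = row_flip A k"
  then obtain k where k: "1 \<le> k" "B = row_flip A k" by blast
  show "\<forall>n\<ge>1. A \<in> Y n \<and> B \<in> Y n \<longrightarrow> n_flip n A B"
  proof (intro allI impI)
    fix n :: nat assume n: "1 \<le> n" "A \<in> Y n \<and> B \<in> Y n"
    \<comment> \<open>Row \<open>k\<close> corresponds to a diagonal only in a polygon with
      \<open>k < N\<close>; the result is carried back to \<open>n\<close> afterwards.\<close>
    define N where "N = max n (k + 1)"
    have N: "A \<in> Y N" "n_flip N A B \<longleftrightarrow> n_flip n A B"
      using n_flip_mono[of n N A B] n by (auto simp: N_def)
    then show "n_flip n A B" using n_flip_row_flip[OF N(1), of k] k by (simp add: N_def)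
  qed
next
  assume flip: "\<forall>n\<ge>1. A \<in> Y n \<and> B \<in> Y n \<longrightarrow> n_flip n A B"
  obtain a b where "\<And>n. a \<le> n \<Longrightarrow> A \<in> Y n" "\<And>n. b \<le> n \<Longrightarrow> B \<in> Y n"
    using young_in_Y assms by metis
  \<comment> \<open>A common size for both diagrams exists, so the hypothesis is not
    vacuous.\<close>
  then have "A \<in> Y (max 1 (max a b))" "B \<in> Y (max 1 (max a b))" by simp_all
  then show "\<exists>k\<ge>1. B = row_flip A k"
    using row_flip_if_n_flip[of A "max 1 (max a b)" B] flip by (metis max.cobounded1)
qed

end
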